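(* Let $\mathcal{K}(\mathbb{X},\tau_{\mathbb{X}})$ be the set of $\tau_{\mathbb{X}}$-compact subsets of $\mathbb{X}=\max(\mathbb{D})$, ordered by reverse inclusion ($C\sqsubseteq C'$ iff $C'\subseteq C$), and let $\mathcal{L}(\mathbb{D})$ be the set of Scott-closed subsets of $\mathbb{D}$, ordered by inclusion. For $d\in\mathbb{D}$ write $\mathord{\uparrow}_{\max}d=\{x\in\max(\mathbb{D}) : d\le x\}$. Define $\gamma:\mathcal{K}(\mathbb{X},\tau_{\mathbb{X}})\to\mathcal{L}(\mathbb{D})$ and $\alpha:\mathcal{L}(\mathbb{D})\to\mathcal{K}(\mathbb{X},\tau_{\mathbb{X}})$ by $\gamma(C)=\{d\in\mathbb{D} : C\subseteq\mathord{\uparrow}_{\max}d\}$ and $\alpha(L)=\bigcap_{d\in L}\mathord{\uparrow}_{\max}d$ (with $\alpha(\emptyset)=\mathbb{X}$). Then these maps are well defined and form a Galois connection with $\alpha$ the upper adjoint of $\gamma$: both are monotone, $L\subseteq\gamma(\alpha(L))$ for all $L\in\mathcal{L}(\mathbb{D})$, and $\alpha(\gamma(C))\sqsubseteq C$ (i.e. $C\subseteq\alpha(\gamma(C))$) for all $C\in\mathcal{K}(\mathbb{X},\tau_{\mathbb{X}})$.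
   Context: Fix a finite set $\mathrm{Act}$ of events. For a dcpo $D$, $K(D)$ denotes its compact elements; a bifinite (SFP) domain is an algebraic dcpo in which, for every finite $F\subseteq K(D)$, the set obtained from $F$ by repeatedly taking sets of minimal upper bounds is finite and contained in $K(D)$, and every upper bound of $F$ lies above a minimal upper bound of $F$. The Scott topology consists of the sets $U$ with $U={\uparrow}(U\cap K(D))$; the Lawson topology is generated by ${\uparrow}k\setminus{\uparrow}l$, $k,l\in K(D)$. The mixed powerdomain $\mathcal{M}(D)$ consists of pairs $(L,U)$ with $L$ Scott-closed, $U$ a Lawson-closed upper set, $L={\downarrow}(L\cap U)$, ordered by $(L,U)\le(L',U')$ iff $L\subseteq L'$ and $U'\subseteq U$. $\mathbb{D}$ is the initial solution over bifinite domains of $\mathbb{D}\cong\prod_{\alpha\in\mathrm{Act}}\mathcal{M}(\mathbb{D})$ (its elements model pointed modal transition systems up to refinement equivalence, maximal elements modelling pointed labelled transition systems up to bisimulation). $\mathbb{X}=\max(\mathbb{D})$ carries the topology $\tau_{\mathbb{X}}=\{U\cap\mathbb{X} : U\text{ Scott-open in }\mathbb{D}\}$. *)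

theory Defs
  imports Complex_Main "HOL-Library.FuncSet"
begin

definition up_set :: "'d::order \<Rightarrow> 'd set" where
  "up_set x = {y. x \<le> y}"

definition upper_closure :: "'d::order set \<Rightarrow> 'd set" where
  "upper_closure A = {y. \<exists>x\<in>A. x \<le> y}"

definition lower_closure :: "'d::order set \<Rightarrow> 'd set" where
  "lower_closure A = {y. \<exists>x\<in>A. y \<le> x}"

definition is_upper :: "'d::order set \<Rightarrow> bool" where
  "is_upper A \<longleftrightarrow> (\<forall>x y. x \<in> A \<and> x \<le> y \<longrightarrow> y \<in> A)"

definition is_ub :: "'d::order set \<Rightarrow> 'd \<Rightarrow> bool" where
  "is_ub S u \<longleftrightarrow> (\<forall>x\<in>S. x \<le> u)"

definition is_lub :: "'d::order set \<Rightarrow> 'd \<Rightarrow> bool" where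
  "is_lub S u \<longleftrightarrow> is_ub S u \<and> (\<forall>v. is_ub S v \<longrightarrow> u \<le> v)"

definition directed :: "'d::order set \<Rightarrow> bool" where
  "directed S \<longleftrightarrow> S \<noteq> {} \<and> (\<forall>x\<in>S. \<forall>y\<in>S. \<exists>z\<in>S. x \<le> z \<and> y \<le> z)"

definition is_dcpo :: "'d::order itself \<Rightarrow> bool" where
  "is_dcpo _ \<longleftrightarrow> (\<forall>S::'d set. directed S \<longrightarrow> (\<exists>u. is_lub S u))"

definition compact_el :: "'d::order \<Rightarrow> bool" where
  "compact_el k \<longleftrightarrow>
     (\<forall>S u. directed S \<and> is_lub S u \<and> k \<le> u \<longrightarrow> (\<exists>s\<in>S. k \<le> s))"

definition K :: "'d::order set" where
  "K = {k. compact_el k}"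

definition algebraic :: "'d::order itself \<Rightarrow> bool" where
  "algebraic _ \<longleftrightarrow>
     (\<forall>x::'d. directed {k\<in>K. k \<le> x} \<and> is_lub {k\<in>K. k \<le> x} x)"

definition mub :: "'d::order set \<Rightarrow> 'd set" where
  "mub F = {u. is_ub F u \<and> (\<forall>v. is_ub F v \<and> v \<le> u \<longrightarrow> v = u)}"

inductive_set mub_closure :: "'d::order set \<Rightarrow> 'd set" for F :: "'d set" where
  base: "x \<in> F \<Longrightarrow> x \<in> mub_closure F"
| step: "finite G \<Longrightarrow> (\<forall>g\<in>G. g \<in> mub_closure F) \<Longrightarrow> m \<in> mub G \<Longrightarrow> m \<in> mub_closure F"

definition bifinite :: "'d::order itself \<Rightarrow> bool" where
  "bifinite T \<longleftrightarrow> is_dcpo T \<and> algebraic T \<and>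
     (\<forall>F::'d set. finite F \<and> F \<subseteq> K \<longrightarrow>
        finite (mub_closure F) \<and> mub_closure F \<subseteq> K \<and>
        (\<forall>u. is_ub F u \<longrightarrow> (\<exists>m\<in>mub F. m \<le> u)))"

definition scott_open :: "'d::order set \<Rightarrow> bool" where
  "scott_open U \<longleftrightarrow> U = upper_closure (U \<inter> K)"

definition scott_closed :: "'d::order set \<Rightarrow> bool" where
  "scott_closed A \<longleftrightarrow> scott_open (- A)"

definition scott_closure :: "'d::order set \<Rightarrow> 'd set" where
  "scott_closure A = \<Inter>{C. scott_closed C \<and> A \<subseteq> C}"

definition lawson_open :: "'d::order set \<Rightarrow> bool" where
  "lawson_open U \<longleftrightarrow>
     generate_topology {up_set k - up_set l | k l. k \<in> K \<and> l \<in> K} U"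

definition lawson_closed :: "'d::order set \<Rightarrow> bool" where
  "lawson_closed A \<longleftrightarrow> lawson_open (- A)"

definition mixed_pd :: "('d::order set \<times> 'd set) set" where
  "mixed_pd = {(L, U). scott_closed L \<and> lawson_closed U \<and> is_upper U \<and>
                        L = lower_closure (L \<inter> U)}"

text \<open>Action of the mixed powerdomain functor on a map \<open>f\<close>
  (Hoare part: Scott closure of the image; Smyth part: upper closure of the image).\<close>
definition mixed_map :: "('d::order \<Rightarrow> 'e::order) \<Rightarrow> 'd set \<times> 'd set \<Rightarrow> 'e set \<times> 'e set" where
  "mixed_map f LU = (scott_closure (f ` fst LU), upper_closure (f ` snd LU))"

definition F_map :: "'a set \<Rightarrow> ('d::order \<Rightarrow> 'e::order) \<Rightarrow>
                     ('a \<Rightarrow> 'd set \<times> 'd set) \<Rightarrow> ('a \<Rightarrow> 'e set \<times> 'e set)" where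
  "F_map Act f \<phi> = (\<lambda>a\<in>Act. mixed_map f (\<phi> a))"

definition bot_el :: "'d::order" where
  "bot_el = (THE b. \<forall>x. b \<le> x)"

primrec approx :: "'a set \<Rightarrow> ('d::order \<Rightarrow> 'a \<Rightarrow> 'd set \<times> 'd set) \<Rightarrow> nat \<Rightarrow> 'd \<Rightarrow> 'd" where
  "approx Act \<iota> 0 = (\<lambda>_. bot_el)"
| "approx Act \<iota> (Suc n) = (\<lambda>x. inv \<iota> (F_map Act (approx Act \<iota> n) (\<iota> x)))"

text \<open>The type \<open>'d\<close> (with its order) together with \<open>\<iota>\<close> is the initial solution of
  \<open>\<DD> \<cong> \<Prod>\<^sub>\<alpha>\<^sub>\<in>\<^sub>A\<^sub>c\<^sub>t M(\<DD>)\<close> over bifinite domains: \<open>\<DD>\<close> is bifinite, \<open>\<iota>\<close> is an order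
  isomorphism onto the product of mixed powerdomains, and (minimal invariance, which
  characterises the initial solution / bilimit from the one-point domain) the identity
  is the supremum of the approximating maps.\<close>
definition initial_solution :: "'a set \<Rightarrow> ('d::order \<Rightarrow> 'a \<Rightarrow> 'd set \<times> 'd set) \<Rightarrow> bool" where
  "initial_solution Act \<iota> \<longleftrightarrow>
     bifinite TYPE('d) \<and>
     bij_betw \<iota> UNIV (Pi\<^sub>E Act (\<lambda>_. mixed_pd)) \<and>
     (\<forall>x y. x \<le> y \<longleftrightarrow> (\<forall>a\<in>Act. fst (\<iota> x a) \<subseteq> fst (\<iota> y a) \<and> snd (\<iota> y a) \<subseteq> snd (\<iota> x a))) \<and>
     (\<forall>x. is_lub (range (\<lambda>n. approx Act \<iota> n x)) x)"

definition Xmax :: "'d::order set" where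
  "Xmax = {x. \<forall>y. x \<le> y \<longrightarrow> y = x}"

definition tauX_compact :: "'d::order set \<Rightarrow> bool" where
  "tauX_compact C \<longleftrightarrow> C \<subseteq> Xmax \<and>
     (\<forall>\<U>. (\<forall>V\<in>\<U>. \<exists>U. scott_open U \<and> V = U \<inter> Xmax) \<and> C \<subseteq> \<Union>\<U> \<longrightarrow>
          (\<exists>\<F>\<subseteq>\<U>. finite \<F> \<and> C \<subseteq> \<Union>\<F>))"

definition up_max :: "'d::order \<Rightarrow> 'd set" where
  "up_max d = {x\<in>Xmax. d \<le> x}"

definition gamma_map :: "'d::order set \<Rightarrow> 'd set" where
  "gamma_map C = {d. C \<subseteq> up_max d}"

definition alpha_map :: "'d::order set \<Rightarrow> 'd set" where
  "alpha_map L = Xmax \<inter> (\<Inter>d\<in>L. up_max d)"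

end

theory Submission
  imports Defs "HOL-Analysis.Function_Topology"
begin

text \<open>The finite approximations \<open>p\<^sub>n = approx Act \<iota> n\<close> are idempotent monotone maps below the
  identity with finite range.  Let \<open>M\<^sub>n\<close> consist of those \<open>x\<close> for which \<open>p\<^sub>n x\<close> is maximal in the
  range of \<open>p\<^sub>n\<close>.  Each \<open>M\<^sub>n\<close> is the upper closure of a finite set, hence Lawson-closed, and a point
  lying in every \<open>M\<^sub>n\<close> is maximal because the identity is the supremum of the \<open>p\<^sub>n\<close>.  Conversely every
  \<open>(L, U)\<close> is refined by \<open>(\<down>(U \<inter> N), U \<inter> N)\<close> with \<open>N = M\<^sub>0 \<inter> \<dots> \<inter> M\<^sub>n\<close>, which shows by
  induction that every point lies below a point of \<open>M\<^sub>0 \<inter> \<dots> \<inter> M\<^sub>n\<close>; a maximal point therefore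
  belongs to every \<open>M\<^sub>n\<close>.  (Lawson compactness of \<open>\<DD>\<close> makes \<open>\<down>(U \<inter> N)\<close> Scott-closed.)  So the
  maximal points are exactly \<open>\<Inter>\<^sub>n M\<^sub>n\<close>, a Lawson-closed set, and \<open>\<alpha>(L)\<close> is Lawson-closed, hence
  compact in the Lawson topology and in the coarser Scott topology.\<close>

section \<open>Scott-closed sets\<close>

lemma up_set_iff [simp]: "y \<in> up_set x \<longleftrightarrow> x \<le> y"
  by (simp add: up_set_def)

lemma scott_open_iff: "scott_open U \<longleftrightarrow> (\<forall>x. x \<in> U \<longleftrightarrow> (\<exists>k\<in>K. k \<in> U \<and> k \<le> x))"
  unfolding scott_open_def upper_closure_def set_eq_iff Int_iff mem_Collect_eq Bex_def by (meson)

lemma scott_closed_iff: "scott_closed A \<longleftrightarrow> (\<forall>x. x \<in> A \<longleftrightarrow> (\<forall>k\<in>K. k \<le> x \<longrightarrow> k \<in> A))"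
  unfolding scott_closed_def scott_open_iff Compl_iff by meson

lemma scott_closedD:
  assumes "scott_closed A" "x \<in> A" "y \<le> x"
  shows "y \<in> A"
  using assms unfolding scott_closed_iff by (meson order_trans)

lemma scott_closed_Inter:
  assumes "\<And>A. A \<in> \<A> \<Longrightarrow> scott_closed A"
  shows "scott_closed (\<Inter>\<A>)"
  using assms unfolding scott_closed_iff Inter_iff by meson

lemma scott_closed_empty: "algebraic TYPE('d::order) \<Longrightarrow> scott_closed ({} :: 'd set)"
  unfolding scott_closed_iff algebraic_def directed_def by blast

lemma algebraic_directed: "algebraic TYPE('d::order) \<Longrightarrow> directed {k\<in>K. k \<le> (x :: 'd)}"
  by (simp add: algebraic_def)

lemma algebraic_bound:
  fixes x :: "'d::order"
  assumes "algebraic TYPE('d)" "k \<in> K" "k \<le> x" "l \<in> K" "l \<le> x"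
  obtains m where "m \<in> K" "m \<le> x" "k \<le> m" "l \<le> m"
  using algebraic_directed[OF assms(1), of x] assms(2-) unfolding directed_def by blast

lemma algebraic_le_iff:
  fixes x y :: "'d::order"
  assumes "algebraic TYPE('d)"
  shows "x \<le> y \<longleftrightarrow> (\<forall>k\<in>K. k \<le> x \<longrightarrow> k \<le> y)"
proof
  assume "\<forall>k\<in>K. k \<le> x \<longrightarrow> k \<le> y"
  then have "is_ub {k\<in>K. k \<le> x} y" by (simp add: is_ub_def)
  then show "x \<le> y" using assms by (auto simp: algebraic_def is_lub_def)
qed (auto intro: order_trans)

text \<open>Directedness of the compact elements below \<open>x\<close> is the point: witnesses
  against \<open>A\<close> and against \<open>B\<close> have a common compact upper bound below
  \<open>x\<close>, which lies in neither set.\<close>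

lemma scott_closed_Un:
  fixes A B :: "'d::order set"
  assumes alg: "algebraic TYPE('d)" and A: "scott_closed A" and B: "scott_closed B"
  shows "scott_closed (A \<union> B)"
  unfolding scott_closed_iff
proof (intro allI iffI ballI impI)
  fix x k assume "x \<in> A \<union> B" "k \<le> x"
  then show "k \<in> A \<union> B" using A B scott_closedD by blast
next
  fix x assume *: "\<forall>k\<in>K. k \<le> x \<longrightarrow> k \<in> A \<union> B"
  show "x \<in> A \<union> B"
  proof (rule ccontr)
    assume "x \<notin> A \<union> B"
    then obtain k l where "k \<in> K" "k \<le> x" "k \<notin> A" "l \<in> K" "l \<le> x" "l \<notin> B"
      using A B unfolding scott_closed_iff by blast
    moreover from this obtain m where "m \<in> K" "m \<le> x" "k \<le> m" "l \<le> m"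
      using algebraic_bound[OF alg] by metis
    ultimately show False using * A B scott_closedD by blast
  qed
qed

lemma scott_closed_lower_closure_finite:
  fixes F :: "'d::order set"
  assumes alg: "algebraic TYPE('d)" and "finite F"
  shows "scott_closed (lower_closure F)"
  using \<open>finite F\<close>
proof induction
  case empty
  then show ?case using scott_closed_empty[OF alg] by (simp add: lower_closure_def)
next
  case (insert x F)
  have "scott_closed {y. y \<le> x}"
    unfolding scott_closed_iff by (simp add: algebraic_le_iff[OF alg, symmetric])
  moreover have "lower_closure (insert x F) = {y. y \<le> x} \<union> lower_closure F"
    by (auto simp: lower_closure_def)
  ultimately show ?case using insert.IH scott_closed_Un[OF alg] by simp
qed

text \<open>This removes the closure operator from \<open>mixed_map\<close> once the approximations
  are known to have finite range.\<close>

lemma scott_closure_finite: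
  fixes F :: "'d::order set"
  assumes alg: "algebraic TYPE('d)" and "finite F"
  shows "scott_closure F = lower_closure F"
proof
  show "scott_closure F \<subseteq> lower_closure F"
    unfolding scott_closure_def using scott_closed_lower_closure_finite[OF assms]
    by (rule_tac Inter_lower) (auto simp: lower_closure_def)
  show "lower_closure F \<subseteq> scott_closure F"
    unfolding scott_closure_def lower_closure_def by (auto dest: scott_closedD)
qed

section \<open>The patch topology\<close>

text \<open>Unlike the generators \<open>\<up>k - \<up>l\<close> of the Lawson topology, the subbase below makes each \<open>\<up>k\<close> open
  even if it contains a greatest element.\<close>
definition patch_open :: "'d::order set \<Rightarrow> bool" where
  "patch_open U \<longleftrightarrow> generate_topology (up_set ` K \<union> uminus ` up_set ` K) U"

definition patch_closed :: "'d::order set \<Rightarrow> bool" where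
  "patch_closed A \<longleftrightarrow> patch_open (- A)"

lemma patch_open_up_set: "k \<in> K \<Longrightarrow> patch_open (up_set k)"
  unfolding patch_open_def by (intro generate_topology.Basis) auto

lemma patch_open_Compl_up_set: "k \<in> K \<Longrightarrow> patch_open (- up_set k)"
  unfolding patch_open_def by (intro generate_topology.Basis) auto

lemma patch_open_Union: "(\<And>U. U \<in> \<U> \<Longrightarrow> patch_open U) \<Longrightarrow> patch_open (\<Union>\<U>)"
  unfolding patch_open_def by (rule generate_topology.UN)

lemma lawson_open_imp_patch_open:
  assumes "lawson_open U"
  shows "patch_open U"
  using assms unfolding lawson_open_def
proof (induction rule: generate_topology.induct)
  case (Basis s)
  then obtain k l where "s = up_set k \<inter> - up_set l" "k \<in> K" "l \<in> K" by auto
  then show ?case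
    using patch_open_up_set patch_open_Compl_up_set
    unfolding patch_open_def by (auto intro: generate_topology.Int)
qed (auto simp: patch_open_def intro: generate_topology.intros)

lemma lawson_closed_imp_patch_closed: "lawson_closed A \<Longrightarrow> patch_closed A"
  unfolding lawson_closed_def patch_closed_def by (rule lawson_open_imp_patch_open)

lemma scott_open_imp_patch_open:
  assumes "scott_open U"
  shows "patch_open U"
proof -
  have "patch_open (\<Union> (up_set ` (U \<inter> K)))"
    by (intro patch_open_Union) (auto intro: patch_open_up_set)
  moreover have "\<Union> (up_set ` (U \<inter> K)) = upper_closure (U \<inter> K)"
    by (auto simp: upper_closure_def)
  ultimately show ?thesis using assms by (simp add: scott_open_def)
qed

lemma patch_closed_up_set_compact: "k \<in> K \<Longrightarrow> patch_closed (up_set k)"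
  unfolding patch_closed_def by (rule patch_open_Compl_up_set)

lemma patch_closed_Int: "patch_closed A \<Longrightarrow> patch_closed B \<Longrightarrow> patch_closed (A \<inter> B)"
  unfolding patch_closed_def Compl_Int using patch_open_Union[of "{- A, - B}"] by auto

lemma lawson_closed_Int: "lawson_closed A \<Longrightarrow> lawson_closed B \<Longrightarrow> lawson_closed (A \<inter> B)"
  unfolding lawson_closed_def lawson_open_def Compl_Int
  using generate_topology.UN[of "{- A, - B}"] by auto

lemma lawson_closed_INT:
  assumes "\<And>i. i \<in> I \<Longrightarrow> lawson_closed (A i)"
  shows "lawson_closed (\<Inter>i\<in>I. A i)"
  using assms unfolding lawson_closed_def lawson_open_def Compl_INT
  by (auto intro!: generate_topology.UN)

lemma lawson_closed_Un: "lawson_closed A \<Longrightarrow> lawson_closed B \<Longrightarrow> lawson_closed (A \<union> B)"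
  unfolding lawson_closed_def lawson_open_def Compl_Un by (rule generate_topology.Int)

lemma lawson_closed_empty: "lawson_closed {}"
  unfolding lawson_closed_def lawson_open_def by (simp add: generate_topology.UNIV)

section \<open>Compactness of the patch topology\<close>

lemma open_coordinate: "open {g :: 'a \<Rightarrow> bool. g k}"
  and closed_coordinate: "closed {g :: 'a \<Rightarrow> bool. g k}"
proof -
  have c: "continuous_on UNIV (\<lambda>g :: 'a \<Rightarrow> bool. g k)"
    by (rule continuous_on_product_coordinates)
  show "open {g :: 'a \<Rightarrow> bool. g k}"
    using open_vimage[OF open_discrete[of "{True}"] c] by (simp add: vimage_def)
  show "closed {g :: 'a \<Rightarrow> bool. g k}"
    using closed_vimage[OF _ c, of "{True}"]
    by (simp add: vimage_def closed_def open_discrete)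
qed

lemma compact_UNIV_bool_fun: "compact (UNIV :: ('a \<Rightarrow> bool) set)"
proof -
  have "compact_space (euclidean :: bool topology)"
    by (simp add: compact_space_def finite_imp_compact)
  then have "compact_space (product_topology (\<lambda>_::'a. euclidean :: bool topology) UNIV)"
    by (simp add: compact_space_product_topology)
  then show ?thesis
    by (simp add: euclidean_product_topology compact_space_def)
qed

text \<open>A point is encoded by the ideal of compact elements below it.  Since binary joins are covered by
  finitely many minimal upper bounds, the ideals form a closed subset of the Cantor cube, so the
  statement reduces to Tychonoff's theorem.\<close>
lemma patch_compact:
  fixes A :: "'i \<Rightarrow> 'd::order set"
  assumes bif: "bifinite TYPE('d)"
    and closed: "\<And>i. i \<in> I \<Longrightarrow> patch_closed (A i)"
    and fip: "\<And>J. finite J \<Longrightarrow> J \<subseteq> I \<Longrightarrow> (\<Inter>i\<in>J. A i) \<noteq> {}"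
  shows "(\<Inter>i\<in>I. A i) \<noteq> {}"
proof -
  have alg: "algebraic TYPE('d)" and dcpo: "is_dcpo TYPE('d)"
    using bif by (auto simp: bifinite_def)
  define f :: "'d \<Rightarrow> 'd \<Rightarrow> bool" where "f x = (\<lambda>k. k \<in> K \<and> k \<le> x)" for x
  \<comment> \<open>Directedness is phrased through minimal upper bounds so that each existential
    ranges over a finite set and defines a closed condition; the clause for \<open>mub {}\<close>
    expresses non-emptiness.\<close>
  define ideals :: "('d \<Rightarrow> bool) set" where
    "ideals = {g. (\<forall>k. g k \<longrightarrow> k \<in> K) \<and> (\<forall>k l. g l \<longrightarrow> k \<in> K \<and> k \<le> l \<longrightarrow> g k)
       \<and> (\<exists>m\<in>mub {}. g m) \<and> (\<forall>k l. k \<in> K \<and> l \<in> K \<longrightarrow> g k \<longrightarrow> g l \<longrightarrow> (\<exists>m\<in>mub {k, l}. g m))}"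
  have mub_K: "mub F \<subseteq> K" and mub_fin: "finite (mub F)" and
    mub_le: "is_ub F u \<Longrightarrow> \<exists>m\<in>mub F. m \<le> u" if "finite F" "F \<subseteq> K" for F :: "'d set" and u
  proof -
    have "mub F \<subseteq> mub_closure F" using that(1) by (auto intro: mub_closure.intros)
    then show "mub F \<subseteq> K" "finite (mub F)" "is_ub F u \<Longrightarrow> \<exists>m\<in>mub F. m \<le> u"
      using that bif unfolding bifinite_def by (blast intro: finite_subset)+
  qed
  have closed_Bex: "closed {g :: 'd \<Rightarrow> bool. \<exists>m\<in>F. g m}" if "finite F" for F
  proof -
    have "closed (\<Union>m\<in>F. {g :: 'd \<Rightarrow> bool. g m})"
      using that by (intro closed_UN) (auto simp: closed_coordinate)
    then show ?thesis by (simp add: Collect_bex_eq)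
  qed
  have "closed {g :: 'd \<Rightarrow> bool. k \<in> K \<and> l \<in> K \<longrightarrow> g k \<longrightarrow> g l \<longrightarrow> (\<exists>m\<in>mub {k, l}. g m)}" for k l
  proof (cases "k \<in> K \<and> l \<in> K")
    case True
    then have "closed {g :: 'd \<Rightarrow> bool. \<exists>m\<in>mub {k, l}. g m}"
      by (intro closed_Bex mub_fin) auto
    then show ?thesis
      using True by (simp only: simp_thms) (intro closed_Collect_imp open_coordinate)
  qed auto
  then have "closed ideals"
    unfolding ideals_def
    by (intro closed_Collect_conj closed_Collect_all)
       (auto intro!: closed_Collect_imp closed_Bex mub_fin open_coordinate closed_coordinate)
  then have "compact ideals"
    using closed_Int_compact[OF _ compact_UNIV_bool_fun] by simp
  have f_ideal: "f x \<in> ideals" for x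
  proof -
    have "\<exists>m\<in>mub {}. m \<in> K \<and> m \<le> x"
      using mub_le[of "{}" x] mub_K[of "{}"] by (auto simp: is_ub_def)
    moreover have "\<exists>m\<in>mub {k, l}. m \<in> K \<and> m \<le> x" if "k \<in> K" "l \<in> K" "k \<le> x" "l \<le> x" for k l
      using mub_le[of "{k, l}" x] mub_K[of "{k, l}"] that by (auto simp: is_ub_def)
    ultimately show ?thesis
      unfolding ideals_def f_def using order_trans by blast
  qed
  have ideal_f: "g \<in> range f" if "g \<in> ideals" for g
  proof -
    have g_K: "\<And>k. g k \<Longrightarrow> k \<in> K" and g_down: "\<And>k l. g l \<Longrightarrow> k \<in> K \<Longrightarrow> k \<le> l \<Longrightarrow> g k"
      and g_mub: "\<And>k l. k \<in> K \<Longrightarrow> l \<in> K \<Longrightarrow> g k \<Longrightarrow> g l \<Longrightarrow> \<exists>m\<in>mub {k, l}. g m"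
      using that unfolding ideals_def mem_Collect_eq by (elim conjE; meson)+
    have "directed {k. g k}"
      unfolding directed_def
    proof (intro conjI ballI)
      show "{k. g k} \<noteq> {}" using that by (auto simp: ideals_def)
      fix x y assume "x \<in> {k. g k}" "y \<in> {k. g k}"
      then obtain m where "m \<in> mub {x, y}" "g m"
        using g_K g_mub[of x y] by auto
      then show "\<exists>z\<in>{k. g k}. x \<le> z \<and> y \<le> z" by (auto simp: mub_def is_ub_def)
    qed
    then obtain u where u: "is_lub {k. g k} u" and dir: "directed {k. g k}"
      using dcpo unfolding is_dcpo_def by blast
    \<comment> \<open>A compact \<open>k\<close> below the supremum \<open>u\<close> already lies
      below a member of the ideal, so the ideal is recovered from \<open>u\<close>.\<close>
    have "f u k \<longleftrightarrow> g k" for k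
    proof
      assume "f u k"
      then have k: "k \<in> K" "k \<le> u" by (simp_all add: f_def)
      then have "\<exists>s\<in>{k. g k}. k \<le> s"
        using u dir unfolding K_def mem_Collect_eq compact_el_def by metis
      then show "g k" using g_down[OF _ k(1)] by auto
    next
      assume "g k"
      then show "f u k"
        using u g_K by (simp add: f_def is_lub_def is_ub_def)
    qed
    then have "f u = g" by blast
    then show ?thesis by blast
  qed
  \<comment> \<open>Patch-open sets are preimages of open sets of the cube, which lets the finite
    intersection property be tested inside \<open>ideals\<close>.\<close>
  have open_preimage: "\<exists>T. open T \<and> U = f -` T" if "patch_open U" for U
    using that unfolding patch_open_def
  proof (induction rule: generate_topology.induct)
    case UNIV
    then show ?case by (intro exI[of _ UNIV]) simp
  next
    case (Int a b)
    then obtain S T where "open S" "a = f -` S" "open T" "b = f -` T" by blast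
    then show ?case by (intro exI[of _ "S \<inter> T"]) auto
  next
    case (UN \<U>)
    then obtain T where T: "\<forall>U\<in>\<U>. open (T U) \<and> U = f -` T U"
      using bchoice[of \<U> "\<lambda>U T. open T \<and> U = f -` T"] by blast
    then have "\<Union>\<U> = f -` (\<Union>U\<in>\<U>. T U)" by blast
    moreover have "open (\<Union>U\<in>\<U>. T U)" using T by blast
    ultimately show ?case by blast
  next
    case (Basis s)
    then consider k where "k \<in> K" "s = up_set k" | k where "k \<in> K" "s = - up_set k" by auto
    then show ?case
    proof cases
      case 1
      then have "s = f -` {g. g k}" by (auto simp: f_def)
      then show ?thesis by (intro exI[of _ "{g. g k}"]) (simp add: open_coordinate)
    next
      case 2
      then have "s = f -` (- {g. g k})" by (auto simp: f_def)
      then show ?thesis by (intro exI[of _ "- {g. g k}"]) (simp add: closed_coordinate open_Compl)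
    qed
  qed
  have "\<forall>i\<in>I. \<exists>T. open T \<and> - A i = f -` T"
    using closed open_preimage unfolding patch_closed_def by meson
  from bchoice[OF this] obtain T where "\<forall>i\<in>I. open (T i) \<and> - A i = f -` T i" ..
  then have T: "\<And>i. i \<in> I \<Longrightarrow> open (T i)" "\<And>i. i \<in> I \<Longrightarrow> - A i = f -` T i"
    by simp_all
  have mem: "x \<in> A i \<longleftrightarrow> f x \<in> - T i" if "i \<in> I" for x i
    using T(2)[OF that] by (metis ComplD ComplI vimage_eq)
  have "ideals \<inter> (\<Inter>i\<in>I. - T i) \<noteq> {}"
  proof (rule compact_imp_fip_image[OF \<open>compact ideals\<close>])
    fix J assume J: "finite J" "J \<subseteq> I"
    then obtain x where "x \<in> (\<Inter>i\<in>J. A i)" using fip by blast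
    then have "f x \<in> (\<Inter>i\<in>J. - T i)"
      using mem J(2) by (auto simp: subset_iff)
    then have "f x \<in> ideals \<inter> (\<Inter>i\<in>J. - T i)"
      using f_ideal by blast
    then show "ideals \<inter> (\<Inter>i\<in>J. - T i) \<noteq> {}" by blast
  qed (rule closed_Compl, rule T(1))
  then obtain x where "f x \<in> (\<Inter>i\<in>I. - T i)" using ideal_f by blast
  then have "x \<in> (\<Inter>i\<in>I. A i)" using mem by simp
  then show ?thesis by blast
qed

text \<open>If every compact \<open>k \<le> x\<close> lies below a point of \<open>C\<close>, the
  closed sets \<open>C \<inter> up_set k\<close> have the finite intersection property by
  directedness. A common point is in \<open>C\<close> and, by algebraicity, above
  \<open>x\<close>.\<close>

lemma scott_closed_lower_closure:
  fixes C :: "'d::order set"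
  assumes bif: "bifinite TYPE('d)" and C: "patch_closed C"
  shows "scott_closed (lower_closure C)"
  unfolding scott_closed_iff
proof (intro allI iffI ballI impI)
  fix x k assume "x \<in> lower_closure C" "k \<le> x"
  then show "k \<in> lower_closure C" unfolding lower_closure_def by (auto intro: order.trans[of k x])
next
  have alg: "algebraic TYPE('d)" using bif by (simp add: bifinite_def)
  fix x assume *: "\<forall>k\<in>K. k \<le> x \<longrightarrow> k \<in> lower_closure C"
  have "(\<Inter>k\<in>{k\<in>K. k \<le> x}. C \<inter> up_set k) \<noteq> {}"
  proof (rule patch_compact[OF bif])
    fix k assume "k \<in> {k\<in>K. k \<le> x}"
    then show "patch_closed (C \<inter> up_set k)"
      by (intro patch_closed_Int C patch_closed_up_set_compact) simp
  next
    fix J assume J: "finite J" "J \<subseteq> {k\<in>K. k \<le> x}"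
    have "\<exists>m\<in>{k\<in>K. k \<le> x}. \<forall>k\<in>J. k \<le> m"
      using J
    proof induction
      case empty
      then show ?case using algebraic_directed[OF alg, of x] by (auto simp: directed_def)
    next
      case (insert k J)
      then obtain m where m: "m \<in> K" "m \<le> x" "\<forall>j\<in>J. j \<le> m" by blast
      obtain m' where m': "m' \<in> K" "m' \<le> x" "k \<le> m'" "m \<le> m'"
        using algebraic_bound[OF alg, of k x m] insert.prems m by blast
      then have "\<forall>j\<in>insert k J. j \<le> m'" using m(3) by (auto intro: order.trans[of _ m])
      then show ?case using m' by blast
    qed
    then obtain m where m: "m \<in> K" "m \<le> x" "\<forall>k\<in>J. k \<le> m" by blast
    then have "m \<in> lower_closure C" using * by blast
    then obtain c where "c \<in> C" "m \<le> c" by (auto simp: lower_closure_def)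
    moreover from this have "\<forall>k\<in>J. k \<le> c" using m(3) by (auto intro: order.trans[of _ m])
    ultimately have "c \<in> (\<Inter>k\<in>J. C \<inter> up_set k)" by simp
    then show "(\<Inter>k\<in>J. C \<inter> up_set k) \<noteq> {}" by blast
  qed
  then obtain c where "c \<in> (\<Inter>k\<in>{k\<in>K. k \<le> x}. C \<inter> up_set k)" by blast
  then have "\<And>k. k \<in> K \<Longrightarrow> k \<le> x \<Longrightarrow> c \<in> C \<and> k \<le> c" unfolding INT_iff by simp
  \<comment> \<open>Membership of \<open>c\<close> in \<open>C\<close> is read off from one index,
    so the index set must be inhabited.\<close>
  moreover have "\<exists>k\<in>K. k \<le> x"
    using algebraic_directed[OF alg, of x] by (auto simp: directed_def)
  ultimately have "c \<in> C" "x \<le> c" unfolding algebraic_le_iff[OF alg, of x c] by auto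
  then show "x \<in> lower_closure C" by (auto simp: lower_closure_def)
qed

section \<open>The finite approximations\<close>

locale refinement_domain =
  fixes Act :: "'a set" and \<iota> :: "'d::order \<Rightarrow> 'a \<Rightarrow> 'd set \<times> 'd set"
  assumes finite_Act: "finite Act" and solution: "initial_solution Act \<iota>"
begin

abbreviation p :: "nat \<Rightarrow> 'd \<Rightarrow> 'd" where "p \<equiv> approx Act \<iota>"
abbreviation may :: "'d \<Rightarrow> 'a \<Rightarrow> 'd set" where "may x a \<equiv> fst (\<iota> x a)"
abbreviation must :: "'d \<Rightarrow> 'a \<Rightarrow> 'd set" where "must x a \<equiv> snd (\<iota> x a)"

lemma bif: "bifinite TYPE('d)"
  and bij: "bij_betw \<iota> UNIV (Pi\<^sub>E Act (\<lambda>_. mixed_pd))"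
  and le_iff: "x \<le> y \<longleftrightarrow> (\<forall>a\<in>Act. may x a \<subseteq> may y a \<and> must y a \<subseteq> must x a)"
  and is_lub_p: "is_lub (range (\<lambda>n. p n x)) x"
  using solution by (auto simp: initial_solution_def)

lemma alg: "algebraic TYPE('d)"
  using bif by (simp add: bifinite_def)

lemma p_le: "p n x \<le> x"
  using is_lub_p[of x] by (auto simp: is_lub_def is_ub_def)

text \<open>The approximation \<open>p 0\<close> is constant with value \<open>bot_el\<close> and
  lies below the identity, so the definite description does denote a least element.\<close>

lemma bot_K: "bot_el \<in> (K :: 'd set)" and bot_le: "bot_el \<le> (x :: 'd)"
proof -
  show le: "bot_el \<le> x" for x :: 'd using p_le[of 0 x] by simp
  show "bot_el \<in> (K :: 'd set)" using le by (auto simp: K_def compact_el_def directed_def)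
qed

text \<open>For compact \<open>k\<close> the complement of \<open>up_set k\<close> is the generator
  \<open>up_set bot_el - up_set k\<close>, because \<open>bot_el\<close> is compact and least. A
  general principal filter is an intersection of compact ones.\<close>

lemma lawson_closed_up_set: "lawson_closed (up_set (x :: 'd))"
proof -
  have "lawson_closed (up_set k)" if "k \<in> K" for k :: 'd
  proof -
    have "- up_set k = up_set bot_el - up_set k" by (auto simp: bot_le)
    then show ?thesis
      unfolding lawson_closed_def lawson_open_def
      using that bot_K by (intro generate_topology.Basis) blast
  qed
  then have "lawson_closed (\<Inter>k\<in>{k\<in>K. k \<le> x}. up_set k)"
    by (intro lawson_closed_INT) auto
  moreover have "(\<Inter>k\<in>{k\<in>K. k \<le> x}. up_set k) = up_set x"
    using algebraic_le_iff[OF alg, of x] by auto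
  ultimately show ?thesis by simp
qed

lemma lawson_closed_upper_closure_finite: "finite (F :: 'd set) \<Longrightarrow> lawson_closed (upper_closure F)"
proof (induction rule: finite_induct)
  case empty
  then show ?case by (simp add: upper_closure_def lawson_closed_empty)
next
  case (insert x F)
  have "upper_closure (insert x F) = up_set x \<union> upper_closure F"
    by (auto simp: upper_closure_def)
  then show ?case by (simp add: insert.IH lawson_closed_up_set lawson_closed_Un)
qed

lemma mixed_pd_\<iota>: "a \<in> Act \<Longrightarrow> \<iota> x a \<in> mixed_pd"
  using bij by (auto simp: bij_betw_def PiE_iff)

lemma may_eq: "a \<in> Act \<Longrightarrow> may x a = lower_closure (may x a \<inter> must x a)"
  and lawson_closed_must: "a \<in> Act \<Longrightarrow> lawson_closed (must x a)"
  and is_upper_must: "a \<in> Act \<Longrightarrow> is_upper (must x a)"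
  using mixed_pd_\<iota>[of a x] by (auto simp: mixed_pd_def split_beta)

lemma may_below_must:
  assumes "a \<in> Act" "y \<in> may x a"
  obtains z where "z \<in> may x a" "z \<in> must x a" "y \<le> z"
  using assms may_eq[OF assms(1), of x] unfolding lower_closure_def by blast

lemma \<iota>_inv:
  assumes "\<And>a. a \<in> Act \<Longrightarrow> \<phi> a \<in> mixed_pd" "a \<in> Act"
  shows "\<iota> (inv \<iota> (\<lambda>a\<in>Act. \<phi> a)) a = \<phi> a"
proof -
  have "(\<lambda>a\<in>Act. \<phi> a) \<in> range \<iota>" using assms(1) bij by (auto simp: bij_betw_def)
  then show ?thesis using assms(2) by (simp add: f_inv_into_f)
qed

text \<open>Finite images make both closures well behaved, and monotonicity preserves the mixed
  condition: if \<open>l\<close> lies below \<open>z\<close> in both components, then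
  \<open>p n l\<close> lies below \<open>p n z\<close>, again in both. Thus
  \<open>inv \<iota>\<close> is applied to a genuine element of the product.\<close>

lemma p_Suc_aux:
  assumes "finite (range (p n))" "mono (p n)" "a \<in> Act"
  shows "\<iota> (p (Suc n) x) a = (lower_closure (p n ` may x a), upper_closure (p n ` must x a))"
proof -
  have fin: "finite (p n ` A)" for A using assms(1) by (rule rev_finite_subset) auto
  have "mixed_map (p n) (\<iota> x b) = (lower_closure (p n ` may x b), upper_closure (p n ` must x b))" for b
    by (simp add: mixed_map_def scott_closure_finite[OF alg fin])
  moreover have "(lower_closure (p n ` may x b), upper_closure (p n ` must x b)) \<in> mixed_pd" (is "(?L, ?U) \<in> _")
    if b: "b \<in> Act" for b
  proof -
    have "?L = lower_closure (?L \<inter> ?U)"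
    proof
      show "?L \<subseteq> lower_closure (?L \<inter> ?U)"
      proof
        fix y assume "y \<in> ?L"
        then obtain l where "l \<in> may x b" "y \<le> p n l" by (auto simp: lower_closure_def)
        moreover from this obtain z where "z \<in> may x b" "z \<in> must x b" "l \<le> z"
          using may_below_must[OF b] by blast
        ultimately have "p n z \<in> ?L \<inter> ?U" "y \<le> p n z"
          using monoD[OF \<open>mono (p n)\<close>, of l z] order_trans
          unfolding lower_closure_def upper_closure_def by blast+
        then show "y \<in> lower_closure (?L \<inter> ?U)" unfolding lower_closure_def by blast
      qed
      show "lower_closure (?L \<inter> ?U) \<subseteq> ?L" unfolding lower_closure_def using order_trans by blast
    qed
    moreover have "is_upper ?U" unfolding is_upper_def upper_closure_def using order_trans by blast
    ultimately show ?thesis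
      using scott_closed_lower_closure_finite[OF alg fin] lawson_closed_upper_closure_finite[OF fin]
      by (simp add: mixed_pd_def)
  qed
  ultimately show ?thesis using \<iota>_inv[OF _ assms(3)] by (simp add: F_map_def)
qed

lemma p_props: "finite (range (p n)) \<and> mono (p n)"
proof (induction n)
  case 0
  then show ?case by (simp add: mono_def)
next
  case (Suc n)
  then have fin: "finite (range (p n))" and mono: "mono (p n)" by auto
  note step = p_Suc_aux[OF fin mono]
  \<comment> \<open>A value of the next approximation is determined by two subsets of the finite
    range of \<open>p n\<close> for each of the finitely many events.\<close>
  have "range (p (Suc n)) \<subseteq> inv \<iota> ` (Pi\<^sub>E Act (\<lambda>_. (\<lambda>(A, B). (scott_closure A, upper_closure B)) `
      (Pow (range (p n)) \<times> Pow (range (p n)))))"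
  proof (rule image_subsetI)
    fix x
    have "F_map Act (p n) (\<iota> x) \<in> Pi\<^sub>E Act (\<lambda>_. (\<lambda>(A, B). (scott_closure A, upper_closure B)) `
      (Pow (range (p n)) \<times> Pow (range (p n))))"
      unfolding F_map_def mixed_map_def restrict_PiE_iff
      by (intro ballI, rule_tac x = "(p n ` may x a, p n ` must x a)" for a in image_eqI) auto
    then show "p (Suc n) x \<in> inv \<iota> ` (Pi\<^sub>E Act (\<lambda>_. (\<lambda>(A, B). (scott_closure A, upper_closure B)) `
      (Pow (range (p n)) \<times> Pow (range (p n)))))"
      unfolding approx.simps by (rule imageI)
  qed
  then have "finite (range (p (Suc n)))"
    by (rule finite_subset) (intro finite_imageI finite_PiE finite_Act; simp add: fin)
  moreover have "mono (p (Suc n))"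
  proof (rule monoI)
    fix x y :: 'd assume "x \<le> y"
    then show "p (Suc n) x \<le> p (Suc n) y"
      unfolding le_iff using step unfolding lower_closure_def upper_closure_def by fastforce
  qed
  ultimately show ?case by blast
qed

lemma finite_range_p: "finite (range (p n))" and p_mono: "x \<le> y \<Longrightarrow> p n x \<le> p n y"
  using p_props[of n] by (auto dest: monoD)

lemma may_p_Suc: "a \<in> Act \<Longrightarrow> may (p (Suc n) x) a = lower_closure (p n ` may x a)"
  and must_p_Suc: "a \<in> Act \<Longrightarrow> must (p (Suc n) x) a = upper_closure (p n ` must x a)"
  using p_Suc_aux p_props by simp_all

text \<open>One inequality is \<open>p_le\<close>. For the other, the induction hypothesis shows
  that a second application of \<open>p n\<close> does not move the generators of either
  component.\<close>

lemma p_idem: "p n (p n x) = p n x"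
proof (induction n arbitrary: x)
  case (Suc n)
  show ?case
  proof (rule antisym[OF p_le])
    show "p (Suc n) x \<le> p (Suc n) (p (Suc n) x)"
      unfolding le_iff
    proof (intro ballI conjI)
      fix a assume a: "a \<in> Act"
      show "may (p (Suc n) x) a \<subseteq> may (p (Suc n) (p (Suc n) x)) a"
        unfolding may_p_Suc[OF a] using Suc.IH unfolding lower_closure_def by fastforce
      show "must (p (Suc n) (p (Suc n) x)) a \<subseteq> must (p (Suc n) x) a"
        unfolding must_p_Suc[OF a]
      proof
        fix z assume "z \<in> upper_closure (p n ` upper_closure (p n ` must x a))"
        then obtain w u where "p n w \<le> z" "u \<in> must x a" "p n u \<le> w"
          by (auto simp: upper_closure_def)
        moreover from this have "p n u \<le> p n w" using p_mono[of "p n u" w n] Suc.IH[of u] by simp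
        ultimately show "z \<in> upper_closure (p n ` must x a)"
          by (auto simp: upper_closure_def intro: order.trans[of _ "p n w"])
      qed
    qed
  qed
qed simp

section \<open>The maximal elements\<close>

definition M :: "nat \<Rightarrow> 'd set" where
  "M n = {x. \<forall>y. p n x \<le> p n y \<longrightarrow> p n y = p n x}"

lemma is_upper_M: "x \<in> M n \<Longrightarrow> x \<le> y \<Longrightarrow> y \<in> M n"
  unfolding M_def mem_Collect_eq using p_mono[of x y n] order.trans by metis

lemma lawson_closed_M: "lawson_closed (M n)"
proof -
  have "M n = upper_closure (p n ` M n)"
  proof
    show "M n \<subseteq> upper_closure (p n ` M n)" using p_le by (auto simp: upper_closure_def)
    have "p n x \<in> M n" if "x \<in> M n" for x using that by (simp add: M_def p_idem)
    then show "upper_closure (p n ` M n) \<subseteq> M n"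
      using is_upper_M by (auto simp: upper_closure_def)
  qed
  moreover have "finite (p n ` M n)" using finite_range_p by (rule rev_finite_subset) auto
  ultimately show ?thesis using lawson_closed_upper_closure_finite by metis
qed

text \<open>When \<open>p (Suc n) x \<le> p (Suc n) y\<close>, must-successors of \<open>x\<close>
  and of \<open>y\<close> can be matched so that the image under \<open>p n\<close> of the former
  lies below that of the latter. Maximality at level \<open>n\<close> turns this into equality, and
  \<open>must x a \<subseteq> may x a\<close> carries it to the may-components.\<close>

lemma M_Suc_I:
  assumes "\<And>a. a \<in> Act \<Longrightarrow> must x a \<subseteq> M n" "\<And>a. a \<in> Act \<Longrightarrow> must x a \<subseteq> may x a"
  shows "x \<in> M (Suc n)"
  unfolding M_def
proof (intro CollectI allI impI antisym)
  fix y assume le: "p (Suc n) x \<le> p (Suc n) y"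
  show "p (Suc n) y \<le> p (Suc n) x"
    unfolding le_iff
  proof (intro ballI conjI)
    fix a assume a: "a \<in> Act"
    have may: "lower_closure (p n ` may x a) \<subseteq> lower_closure (p n ` may y a)"
      and must: "upper_closure (p n ` must y a) \<subseteq> upper_closure (p n ` must x a)"
      using le a unfolding le_iff by (auto simp: may_p_Suc must_p_Suc simp del: approx.simps)
    show "may (p (Suc n) y) a \<subseteq> may (p (Suc n) x) a"
      unfolding may_p_Suc[OF a]
    proof
      fix z assume "z \<in> lower_closure (p n ` may y a)"
      then obtain l where "l \<in> may y a" "z \<le> p n l" by (auto simp: lower_closure_def)
      moreover from this obtain u where u: "u \<in> must y a" "l \<le> u"
        using may_below_must[OF a] by blast
      moreover obtain v where "v \<in> must x a" "p n v \<le> p n u"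
        using must u(1) unfolding upper_closure_def by blast
      moreover from this have "p n u = p n v" using assms(1)[OF a] by (auto simp: M_def)
      ultimately have "z \<le> p n v" "v \<in> may x a"
        using p_mono[of l u n] assms(2)[OF a] by auto
      then show "z \<in> lower_closure (p n ` may x a)" by (auto simp: lower_closure_def)
    qed
    show "must (p (Suc n) x) a \<subseteq> must (p (Suc n) y) a"
      unfolding must_p_Suc[OF a]
    proof
      fix z assume "z \<in> upper_closure (p n ` must x a)"
      then obtain v where v: "v \<in> must x a" "p n v \<le> z" by (auto simp: upper_closure_def)
      then have "p n v \<in> lower_closure (p n ` may y a)"
        using may assms(2)[OF a] by (auto simp: lower_closure_def)
      then obtain l where l: "l \<in> may y a" "p n v \<le> p n l" by (auto simp: lower_closure_def)
      \<comment> \<open>Passing from \<open>l\<close> to a must-successor above it keeps the image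
        above \<open>p n v\<close>, so maximality of \<open>p n v\<close> applies to
        \<open>u\<close>.\<close>
      moreover obtain u where "u \<in> must y a" "l \<le> u"
        using may_below_must[OF a l(1)] by metis
      ultimately have "u \<in> must y a" "p n v \<le> p n u"
        using order.trans[of "p n v" "p n l", OF _ p_mono] by auto
      moreover from this have "p n u = p n v" using v(1) assms(1)[OF a] by (auto simp: M_def)
      then have "p n u \<le> z" using v(2) by simp
      ultimately show "z \<in> upper_closure (p n ` must y a)" by (auto simp: upper_closure_def)
    qed
  qed
qed (use p_mono in auto)

lemma M_dense: "\<exists>y\<ge>x. \<forall>i\<le>n. y \<in> M i"
proof (induction n arbitrary: x)
  case 0
  then show ?case by (auto simp: M_def)
next
  case (Suc n)
  \<comment> \<open>All levels up to \<open>n\<close> are imposed on the successors together, so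
    that \<open>M_Suc_I\<close> yields every level from \<open>1\<close> to \<open>Suc n\<close> for
    the same \<open>y\<close>; level \<open>0\<close> is the whole domain.\<close>
  define N where "N = (\<Inter>i\<in>{..n}. M i)"
  define C where "C a = must x a \<inter> N" for a
  have upper_N: "is_upper N"
    unfolding is_upper_def N_def by (simp, meson is_upper_M)
  have "lawson_closed N" unfolding N_def by (intro lawson_closed_INT lawson_closed_M)
  then have C: "lawson_closed (C a)" if "a \<in> Act" for a
    unfolding C_def using lawson_closed_must[OF that] lawson_closed_Int by blast
  have C_pd: "(lower_closure (C a), C a) \<in> mixed_pd" if a: "a \<in> Act" for a
  proof -
    have "is_upper (C a)"
      using is_upper_must[OF a, of x] upper_N unfolding is_upper_def C_def by blast
    moreover have "lower_closure (C a) \<inter> C a = C a" by (auto simp: lower_closure_def)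
    ultimately show ?thesis
      using C[OF a] scott_closed_lower_closure[OF bif lawson_closed_imp_patch_closed[OF C[OF a]]]
      by (simp add: mixed_pd_def)
  qed
  define y where "y = inv \<iota> (\<lambda>a\<in>Act. (lower_closure (C a), C a))"
  have y: "\<iota> y a = (lower_closure (C a), C a)" if "a \<in> Act" for a
    unfolding y_def by (rule \<iota>_inv[OF C_pd that])
  have "x \<le> y"
    unfolding le_iff
  proof (intro ballI conjI)
    fix a assume a: "a \<in> Act"
    show "must y a \<subseteq> must x a" using y[OF a] by (simp add: C_def)
    show "may x a \<subseteq> may y a"
    proof
      fix l assume "l \<in> may x a"
      then obtain u where u: "u \<in> must x a" "l \<le> u" using may_below_must[OF a] by metis
      \<comment> \<open>The induction hypothesis raises the must-successor \<open>u\<close> into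
        \<open>N\<close>. The result is still a must-successor because \<open>must x a\<close> is an
        upper set, so no may-behaviour is lost by shrinking to \<open>C a\<close>.\<close>
      obtain v where v: "u \<le> v" "v \<in> N" using Suc.IH[of u] by (auto simp: N_def)
      have "v \<in> C a"
        using is_upper_must[OF a, of x] u(1) v unfolding C_def is_upper_def by blast
      moreover have "l \<le> v" using u(2) v(1) by (rule order.trans)
      ultimately show "l \<in> may y a" using y[OF a] by (auto simp: lower_closure_def)
    qed
  qed
  moreover have "y \<in> M i" if "i \<le> Suc n" for i
  proof (cases i)
    case 0
    then show ?thesis by (simp add: M_def)
  next
    case (Suc j)
    then have "N \<subseteq> M j" using that by (auto simp: N_def)
    then show ?thesis
      unfolding Suc using y by (intro M_Suc_I) (auto simp: C_def lower_closure_def)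
  qed
  ultimately show ?case by blast
qed

lemma Xmax_eq: "Xmax = (\<Inter>n. M n)"
proof
  show "(\<Inter>n. M n) \<subseteq> Xmax"
    unfolding Xmax_def
  proof clarify
    fix x y assume x: "x \<in> (\<Inter>n. M n)" and "x \<le> y"
    \<comment> \<open>Points with the same approximations at every level are suprema of the same
      set.\<close>
    then have "p n y = p n x" for n using p_mono by (auto simp: M_def)
    then have "is_lub (range (\<lambda>n. p n x)) y" using is_lub_p[of y] by simp
    then show "y = x" using is_lub_p[of x] by (auto simp: is_lub_def intro: antisym)
  qed
  show "Xmax \<subseteq> (\<Inter>n. M n)"
  proof
    fix x :: 'd assume x: "x \<in> Xmax"
    \<comment> \<open>Density gives a point of \<open>M n\<close> above \<open>x\<close>; maximality
      of \<open>x\<close> forces it to be \<open>x\<close> itself.\<close>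
    have "x \<in> M n" for n using M_dense[of x n] x by (auto simp: Xmax_def)
    then show "x \<in> (\<Inter>n. M n)" by simp
  qed
qed

section \<open>Compactness of \<alpha>(L), closedness of \<gamma>(C), and the Galois
  connection\<close>

lemma tauX_compact_lawson_closed:
  assumes "lawson_closed C" "C \<subseteq> (Xmax :: 'd set)"
  shows "tauX_compact C"
  unfolding tauX_compact_def
proof (intro conjI allI impI assms(2), elim conjE)
  fix \<U> assume open_U: "\<forall>V\<in>\<U>. \<exists>U. scott_open U \<and> V = U \<inter> Xmax" and cover: "C \<subseteq> \<Union>\<U>"
  then obtain W where W: "\<And>V. V \<in> \<U> \<Longrightarrow> scott_open (W V)" "\<And>V. V \<in> \<U> \<Longrightarrow> V = W V \<inter> Xmax"
    by metis
  show "\<exists>\<F>\<subseteq>\<U>. finite \<F> \<and> C \<subseteq> \<Union>\<F>"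
  proof (rule ccontr)
    assume contra: "\<not> (\<exists>\<F>\<subseteq>\<U>. finite \<F> \<and> C \<subseteq> \<Union>\<F>)"
    \<comment> \<open>The index \<open>None\<close> stands for \<open>C\<close> and
      \<open>Some V\<close> for the complement of the Scott-open set tracing out \<open>V\<close>.
      Without a finite subcover, this family has the finite intersection property.\<close>
    define A where "A = case_option C (\<lambda>V. - W V)"
    have "(\<Inter>i\<in>insert None (Some ` \<U>). A i) \<noteq> {}"
    proof (rule patch_compact[OF bif])
      fix i assume "i \<in> insert None (Some ` \<U>)"
      then show "patch_closed (A i)"
        using lawson_closed_imp_patch_closed[OF assms(1)] scott_open_imp_patch_open[OF W(1)]
        by (auto simp: A_def patch_closed_def)
    next
      fix J assume J: "finite J" "J \<subseteq> insert None (Some ` \<U>)"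
      define \<F> where "\<F> = Some -` J"
      have "finite \<F>" "\<F> \<subseteq> \<U>"
        using J by (auto simp: \<F>_def intro: finite_vimageI)
      then obtain x where "x \<in> C" "x \<notin> \<Union>\<F>" using contra by blast
      moreover have "x \<in> - W V" if "Some V \<in> J" for V
        \<comment> \<open>Inside \<open>Xmax\<close>, avoiding the trace \<open>V\<close> is the
          same as avoiding \<open>W V\<close>, and \<open>x\<close> is maximal because it lies in
          \<open>C\<close>.\<close>
        using that calculation \<open>\<F> \<subseteq> \<U>\<close> W(2)[of V] assms(2) by (auto simp: \<F>_def)
      ultimately have "x \<in> (\<Inter>i\<in>J. A i)"
        by (auto simp: A_def split: option.split)
      then show "(\<Inter>i\<in>J. A i) \<noteq> {}" by blast
    qed
    then obtain x where "x \<in> C" "\<And>V. V \<in> \<U> \<Longrightarrow> x \<notin> W V" by (auto simp: A_def)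
    then show False using cover W(2) by blast
  qed
qed

lemma tauX_compact_alpha_map: "tauX_compact (alpha_map (L :: 'd set))"
proof (rule tauX_compact_lawson_closed)
  have "alpha_map L = (\<Inter>n. M n) \<inter> (\<Inter>d\<in>L. up_set d)"
    unfolding Xmax_eq[symmetric] alpha_map_def up_max_def by auto
  then show "lawson_closed (alpha_map L)"
    by (simp add: lawson_closed_Int lawson_closed_INT lawson_closed_M lawson_closed_up_set)
qed (auto simp: alpha_map_def)

text \<open>The set of common lower bounds of \<open>C\<close> is an intersection of principal
  ideals, each of them Scott-closed.\<close>

lemma scott_closed_gamma_map:
  assumes "C \<subseteq> (Xmax :: 'd set)"
  shows "scott_closed (gamma_map C)"
proof -
  have "gamma_map C = (\<Inter>c\<in>C. lower_closure {c})"
    using assms by (auto simp: gamma_map_def up_max_def lower_closure_def)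
  then show ?thesis
    by (auto intro!: scott_closed_Inter scott_closed_lower_closure_finite[OF alg])
qed

end

theorem theorem4p6:
  fixes Act :: "'a set" and \<iota> :: "'d::order \<Rightarrow> 'a \<Rightarrow> 'd set \<times> 'd set"
  assumes "finite Act"
    and "initial_solution Act \<iota>"
  shows "(\<forall>C::'d set. tauX_compact C \<longrightarrow> scott_closed (gamma_map C))
       \<and> (\<forall>L::'d set. scott_closed L \<longrightarrow> tauX_compact (alpha_map L))
       \<and> (\<forall>C C'::'d set. tauX_compact C \<and> tauX_compact C' \<and> C' \<subseteq> C \<longrightarrow> gamma_map C \<subseteq> gamma_map C')
       \<and> (\<forall>L L'::'d set. scott_closed L \<and> scott_closed L' \<and> L \<subseteq> L' \<longrightarrow> alpha_map L' \<subseteq> alpha_map L)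
       \<and> (\<forall>L::'d set. scott_closed L \<longrightarrow> L \<subseteq> gamma_map (alpha_map L))
       \<and> (\<forall>C::'d set. tauX_compact C \<longrightarrow> C \<subseteq> alpha_map (gamma_map C))"
proof -
  interpret refinement_domain Act \<iota>
    using assms by (rule refinement_domain.intro)
  have "C \<subseteq> Xmax" if "tauX_compact C" for C :: "'d set"
    using that by (simp add: tauX_compact_def)
  \<comment> \<open>Well-definedness is the substantive part; monotonicity and the two adjunction
    inequalities follow by unfolding both maps as sets of common lower bounds and of common maximal
    upper bounds.\<close>
  then show ?thesis
    using scott_closed_gamma_map tauX_compact_alpha_map
    by (auto simp: gamma_map_def alpha_map_def)
qed

end
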